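(* Let $\{w^k\}_{k\ge 0}$, $w^k=(x^k,\lambda^k)$, and $\{\tilde w^k\}_{k\ge 0}$, $\tilde w^k=(\tilde x^k,\tilde\lambda^k)$, be the sequences generated by the prediction-correction formulation of the I-IDL-ALM (described in the context) for solving $\min\{\theta(x)\mid Ax\ge b,\ x\in\mathcal X\}$, with parameters $\beta>0$, $r>\beta\rho(A^TA)$. Then, for any $\tau\in(0.75,1)$, the sequence $\{w^k\}$ converges to some $w^\infty\in\Omega^\ast$.
   Context: Setting: $\theta:\mathbb R^n\to\mathbb R$ is a closed proper convex (not necessarily smooth) function, $\mathcal X\subset\mathbb R^n$ is a nonempty closed convex set, $A\in\mathbb R^{m\times n}$, $b\in\mathbb R^m$. The problem is $\min\{\theta(x)\mid Ax\ge b,\ x\in\mathcal X\}$, whose solution set is assumed nonempty. $\rho(\cdot)$ denotes the spectral radius, $\|\cdot\|$ the Euclidean norm, and $[\cdot]_+$ the projection onto the nonnegative orthant $\mathbb R^m_+$. Let $\Omega=\mathcal X\times\mathbb R^m_+$, $w=(x,\lambda)$, and $F(w)=(-A^T\lambda,\ Ax-b)$. $\Omega^\ast$ is the solution set of the variational inequality: find $w^\ast=(x^\ast,\lambda^\ast)\in\Omega$ such that $\theta(x)-\theta(x^\ast)+(w-w^\ast)^TF(w^\ast)\ge 0$ for all $w=(x,\lambda)\in\Omega$. Equivalently, $\Omega^\ast$ is the set of saddle points on $\mathcal X\times\mathbb R^m_+$ of the Lagrangian $L(x,\lambda)=\theta(x)-\lambda^T(Ax-b)$. It is assumed that $\Omega^\ast\neq\emptyset$.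 I-IDL-ALM (inequality version of the indefinite linearized augmented Lagrangian method), prediction-correction form: starting from an arbitrary $(x^0,\lambda^0)\in\mathbb R^n\times\mathbb R^m$, for $k=0,1,2,\dots$, prediction: $\tilde\lambda^k=[\lambda^k-\beta(Ax^k-b)]_+$, $\ \tilde x^k=\arg\min\{\theta(x)-(\tilde\lambda^k)^TAx+\frac{\tau r}{2}\|x-x^k\|^2\mid x\in\mathcal X\}$; correction: $x^{k+1}=\tilde x^k$, $\ \lambda^{k+1}=\tilde\lambda^k+\beta A(x^k-x^{k+1})$. *)

theory Defs
  imports "HOL-Analysis.Analysis"
begin

(* The eigenvalues of a real matrix are its complex ones. *)
definition complex_eigenvalues :: "real^'n^'n \<Rightarrow> complex set" where
  "complex_eigenvalues M =
     {c. \<exists>v :: complex^'n. v \<noteq> 0 \<and> map_matrix complex_of_real M *v v = c *s v}"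

(* The set of eigenvalues is finite and nonempty, so the supremum is a maximum. *)
definition spectral_radius :: "real^'n^'n \<Rightarrow> real" where
  "spectral_radius M = (SUP c \<in> complex_eigenvalues M. cmod c)"

(* A real-valued function is automatically proper; "closed" means closed epigraph. *)
definition closed_proper_convex :: "(real^'n \<Rightarrow> real) \<Rightarrow> bool" where
  "closed_proper_convex f \<longleftrightarrow> convex_on UNIV f \<and> closed (epigraph UNIV f)"

definition nonneg_orthant :: "(real^'m) set" where
  "nonneg_orthant = {l. 0 \<le> l}"

definition proj_nonneg :: "real^'m \<Rightarrow> real^'m" where
  "proj_nonneg v = closest_point nonneg_orthant v"

(* The order on vectors is componentwise. *)
definition solution_set ::
  "(real^'n \<Rightarrow> real) \<Rightarrow> (real^'n) set \<Rightarrow> real^'n^'m \<Rightarrow> real^'m \<Rightarrow> (real^'n) set" where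
  "solution_set \<theta> X A b = {x. is_arg_min \<theta> (\<lambda>y. y \<in> X \<and> b \<le> A *v y) x}"

definition Omega :: "(real^'n) set \<Rightarrow> ((real^'n) \<times> (real^'m)) set" where
  "Omega X = X \<times> nonneg_orthant"

definition VI_map ::
  "real^'n^'m \<Rightarrow> real^'m \<Rightarrow> (real^'n) \<times> (real^'m) \<Rightarrow> (real^'n) \<times> (real^'m)" where
  "VI_map A b w = (- (transpose A *v snd w), A *v fst w - b)"

definition Omega_star ::
  "(real^'n \<Rightarrow> real) \<Rightarrow> (real^'n) set \<Rightarrow> real^'n^'m \<Rightarrow> real^'m \<Rightarrow> ((real^'n) \<times> (real^'m)) set" where
  "Omega_star \<theta> X A b =
     {ws \<in> Omega X. \<forall>w \<in> Omega X.
        \<theta> (fst w) - \<theta> (fst ws) + (w - ws) \<bullet> VI_map A b ws \<ge> 0}"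

(* w and wt are the sequences (x^k, lambda^k) and (xt^k, lambdat^k) of iterates and predictors;
   the minimiser in the prediction step is unique by strong convexity when tau * r > 0. *)
definition I_IDL_ALM ::
  "(real^'n \<Rightarrow> real) \<Rightarrow> (real^'n) set \<Rightarrow> real^'n^'m \<Rightarrow> real^'m \<Rightarrow> real \<Rightarrow> real \<Rightarrow> real \<Rightarrow>
   (nat \<Rightarrow> (real^'n) \<times> (real^'m)) \<Rightarrow> (nat \<Rightarrow> (real^'n) \<times> (real^'m)) \<Rightarrow> bool" where
  "I_IDL_ALM \<theta> X A b \<beta> r \<tau> w wt \<longleftrightarrow>
     (\<forall>k. snd (wt k) = proj_nonneg (snd (w k) - \<beta> *\<^sub>R (A *v fst (w k) - b)) \<and>
          is_arg_min
            (\<lambda>x. \<theta> x - snd (wt k) \<bullet> (A *v x) + \<tau> * r / 2 * (norm (x - fst (w k)))\<^sup>2)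
            (\<lambda>x. x \<in> X) (fst (wt k)) \<and>
          fst (w (Suc k)) = fst (wt k) \<and>
          snd (w (Suc k)) = snd (wt k) + \<beta> *\<^sub>R (A *v (fst (w k) - fst (w (Suc k)))))"

end

theory Submission
  imports Defs
begin

text \<open>
  The iteration is a proximal-type method for the saddle points of the Lagrangian
  \<open>L y \<mu> = \<theta> y - \<mu> \<bullet> (A y - b)\<close>. Put \<open>d\<^sub>k = x\<^sub>k - x\<^sub>k\<^sub>+\<^sub>1\<close> and \<open>e\<^sub>k = l\<^sub>k - l\<^sub>k\<^sub>+\<^sub>1\<close>. The optimality
  conditions of one step, tested at a saddle point, show that the weighted squared distance
  \<open>\<tau> r |x - x*|\<^sup>2 + |l - l*|\<^sup>2 / \<beta>\<close> to it decreases in step \<open>k\<close> by at least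
  \<open>\<tau> r |d\<^sub>k|\<^sup>2 + |e\<^sub>k|\<^sup>2 / \<beta> + 2 (A d\<^sub>k) \<bullet> e\<^sub>k\<close>. For \<open>\<tau> < 1\<close> this quantity can be negative, because
  \<open>\<tau> r\<close> can be smaller than \<open>\<beta> |A|\<^sup>2\<close>.

  The remedy is to treat the two halves of the cross term differently. One half is absorbed by
  completing the square \<open>|e\<^sub>k + (\<beta>/2) A d\<^sub>k|\<^sup>2 / \<beta>\<close>, which costs \<open>(\<beta>/4) |A d\<^sub>k|\<^sup>2\<close>. For the other half, the
  optimality conditions of two consecutive minimisations give a lower bound on \<open>(A d\<^sub>k) \<bullet> e\<^sub>k\<close>
  that telescopes up to a loss of \<open>2 (1 - \<tau>) \<beta> |A d\<^sub>k|\<^sup>2\<close>. Since \<open>\<beta> |A d|\<^sup>2 \<le> r |d|\<^sup>2\<close>, what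
  remains is at least \<open>(\<tau> - 2 (1 - \<tau>) - 1/4) r |d\<^sub>k|\<^sup>2 = 3 (\<tau> - 3/4) r |d\<^sub>k|\<^sup>2\<close>, and this is where the
  bound \<open>3/4\<close> comes from. Splitting the cross term evenly is optimal: a share \<open>t\<close> of telescoping
  requires \<open>\<tau> > 4 t (1 - \<tau>) + (1 - t)\<^sup>2\<close>, and \<open>t = 1/2\<close> is best at the threshold.

  So a nonnegative potential decreases (\<open>potential_decrease\<close>), the iterates are bounded, and
  \<open>d\<^sub>k\<close> and \<open>e\<^sub>k\<close> tend to zero. In the limit, the optimality conditions say that every cluster point is a saddle
  point (\<open>cluster_point_saddle\<close>). The potential that belongs to a cluster point tends to zero along a
  subsequence, hence entirely, which gives convergence of the whole sequence.

  The inequality \<open>\<beta> |A d|\<^sup>2 \<le> r |d|\<^sup>2\<close> comes from the spectral radius of \<open>A\<^sup>T A\<close>: the maximum of \<open>|A v|\<^sup>2\<close> on the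
  unit sphere is an eigenvalue of \<open>A\<^sup>T A\<close>.
\<close>

section \<open>Quadratic inequalities and first-order conditions\<close>

lemma nonneg_if_quadratic_nonneg:
  fixes a c :: real
  assumes "\<And>t. 0 < t \<Longrightarrow> t \<le> 1 \<Longrightarrow> 0 \<le> t * a + t\<^sup>2 * c"
  shows "0 \<le> a"
proof -
  have ev: "\<forall>\<^sub>F t in at_right 0. 0 \<le> a + t * c"
    unfolding eventually_at_right_field
  proof (intro exI[of _ 1] conjI allI impI)
    fix t :: real assume t: "0 < t" "t < 1"
    have "0 \<le> t * (a + t * c)"
      using assms[of t] t by (simp add: algebra_simps power2_eq_square)
    then show "0 \<le> a + t * c"
      using t by (simp add: zero_le_mult_iff)
  qed simp
  have "((\<lambda>t. a + t * c) \<longlongrightarrow> a + 0 * c) (at_right 0)"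
    by (intro tendsto_intros)
  from tendsto_lowerbound[OF this ev] show ?thesis by simp
qed

text \<open>
  Compare the minimiser \<open>z\<close> with the points of the segment from \<open>z\<close> to \<open>y\<close>: convexity bounds the change of
  \<open>\<theta>\<close> linearly, so no derivative of \<open>\<theta>\<close> is needed.
\<close>

lemma proximal_minimiser_variational:
  fixes z y q c :: "'a::real_inner"
  assumes conv: "convex_on X \<theta>" "convex X"
    and min: "is_arg_min (\<lambda>x. \<theta> x - g x + s / 2 * (norm (x - c))\<^sup>2) (\<lambda>x. x \<in> X) z"
    and lin: "linear g"
    and y: "y \<in> X"
  shows "s * ((y - z) \<bullet> (c - z)) \<le> \<theta> y - \<theta> z - g (y - z)"
proof -
  have z: "z \<in> X" using min by (simp add: is_arg_min_def)
  have "0 \<le> t * (\<theta> y - \<theta> z - g (y - z) - s * ((y - z) \<bullet> (c - z)))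
            + t\<^sup>2 * (s / 2 * (norm (y - z))\<^sup>2)" if t: "0 < t" "t \<le> 1" for t
  proof -
    define p where "p = z + t *\<^sub>R (y - z)"
    have p: "p = (1 - t) *\<^sub>R z + t *\<^sub>R y"
      by (simp add: p_def algebra_simps)
    have pX: "p \<in> X"
      unfolding p using conv(2) z y t by (auto simp: convex_alt)
    have "\<theta> p \<le> (1 - t) * \<theta> z + t * \<theta> y"
      unfolding p using convex_onD[OF conv(1), of t z y] t z y by simp
    moreover have "\<theta> z - g z + s / 2 * (norm (z - c))\<^sup>2 \<le> \<theta> p - g p + s / 2 * (norm (p - c))\<^sup>2"
      using min pX by (auto simp: is_arg_min_def not_less)
    moreover have "g p = g z + t * g (y - z)"
      by (simp add: p_def linear_add[OF lin] linear_scale[OF lin])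
    moreover have "(norm (p - c))\<^sup>2
        = (norm (z - c))\<^sup>2 - 2 * t * ((y - z) \<bullet> (c - z)) + t\<^sup>2 * (norm (y - z))\<^sup>2"
    proof -
      have "(norm (t *\<^sub>R h - f))\<^sup>2 = (norm f)\<^sup>2 - 2 * t * (h \<bullet> f) + t\<^sup>2 * (norm h)\<^sup>2"
        for h f :: 'a
        unfolding power2_norm_eq_inner
        by (simp add: inner_diff inner_commute algebra_simps power2_eq_square)
      moreover have "p - c = t *\<^sub>R (y - z) - (c - z)" by (simp add: p_def)
      ultimately show ?thesis by (simp only: norm_minus_commute[of z c])
    qed
    then have "s / 2 * (norm (p - c))\<^sup>2 = s / 2 * (norm (z - c))\<^sup>2
        - t * (s * ((y - z) \<bullet> (c - z))) + t\<^sup>2 * (s / 2 * (norm (y - z))\<^sup>2)"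
      by (simp only:) (simp add: algebra_simps)
    ultimately show ?thesis by (simp add: algebra_simps)
  qed
  from nonneg_if_quadratic_nonneg[OF this] show ?thesis by simp
qed

lemma tendsto_zero_if_square_le:
  fixes f :: "nat \<Rightarrow> 'c::real_normed_vector"
  assumes "0 < c" "\<And>k. c * (norm (f k))\<^sup>2 \<le> g k" "g \<longlonglongrightarrow> 0"
  shows "f \<longlonglongrightarrow> 0"
proof -
  have "(\<lambda>k. g k / c) \<longlonglongrightarrow> 0 / c"
    using assms(1) by (intro tendsto_divide assms(3) tendsto_const) simp
  then have "(\<lambda>k. g k / c) \<longlonglongrightarrow> 0" by simp
  then have "(\<lambda>k. (norm (f k))\<^sup>2) \<longlonglongrightarrow> 0"
    by (rule tendsto_sandwich[OF _ _ tendsto_const, rotated 2])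
       (use assms(1,2) in \<open>simp_all add: pos_le_divide_eq mult.commute\<close>)
  then have "(\<lambda>k. sqrt ((norm (f k))\<^sup>2)) \<longlonglongrightarrow> sqrt 0"
    by (rule tendsto_real_sqrt)
  then show ?thesis by (simp add: tendsto_norm_zero_iff)
qed

section \<open>The spectral radius of the Gram matrix\<close>

text \<open>
  A supremum of reals bounds the members of a set only if the set is bounded above; here the operator norm of
  the complexified matrix is a bound.
\<close>

lemma bdd_above_complex_eigenvalues:
  fixes M :: "real^'n^'n"
  shows "bdd_above (cmod ` complex_eigenvalues M)"
proof -
  let ?f = "\<lambda>v :: complex^'n. map_matrix complex_of_real M *v v"
  have "bounded_linear ?f"
    by (rule linear_linear[THEN iffD2], rule linearI)
       (simp_all add: matrix_vector_right_distrib, simp add: vec_eq_iff matrix_vector_mult_def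
          scaleR_sum_right)
  then obtain K where K: "\<And>v. norm (?f v) \<le> norm v * K"
    using bounded_linear.bounded by blast
  have "cmod c \<le> K" if "c \<in> complex_eigenvalues M" for c
  proof -
    from that obtain v :: "complex^'n" where v: "v \<noteq> 0" "?f v = c *s v"
      by (auto simp: complex_eigenvalues_def)
    have "norm (c *s v) = cmod c * norm v"
      by (simp add: norm_vec_def norm_mult L2_set_right_distrib)
    with K[of v] v show ?thesis by (simp add: mult.commute)
  qed
  then show ?thesis by (auto intro!: bdd_aboveI[of _ K])
qed

lemma real_eigenvalue_le_spectral_radius:
  fixes M :: "real^'n^'n"
  assumes "v \<noteq> 0" "M *v v = \<mu> *\<^sub>R v"
  shows "\<bar>\<mu>\<bar> \<le> spectral_radius M"
proof -
  let ?v = "(\<chi> i. complex_of_real (v $ i)) :: complex^'n"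
  have "(M *v v) $ i = \<mu> * v $ i" for i
    using assms(2) by simp
  then have "(\<Sum>j\<in>UNIV. complex_of_real (M $ i $ j) * complex_of_real (v $ j))
      = complex_of_real \<mu> * complex_of_real (v $ i)" for i
    unfolding matrix_vector_mult_def by (simp flip: of_real_mult of_real_sum)
  then have "map_matrix complex_of_real M *v ?v = complex_of_real \<mu> *s ?v"
    by (simp add: vec_eq_iff matrix_vector_mult_def map_matrix_def)
  moreover have "?v \<noteq> 0" using assms(1) by (simp add: vec_eq_iff)
  ultimately have "complex_of_real \<mu> \<in> complex_eigenvalues M"
    by (auto simp: complex_eigenvalues_def)
  then have "cmod (complex_of_real \<mu>) \<le> spectral_radius M"
    unfolding spectral_radius_def by (rule cSUP_upper) (rule bdd_above_complex_eigenvalues)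
  then show ?thesis by simp
qed

text \<open>
  Let \<open>\<mu>\<close> be the maximum of \<open>|A v|\<^sup>2\<close> over unit vectors. The quadratic form \<open>\<mu> |x|\<^sup>2 - |A x|\<^sup>2\<close> is
  nonnegative and vanishes at a maximiser \<open>v\<close>, so its gradient vanishes there, that is,
  \<open>A\<^sup>T A v = \<mu> v\<close>.
\<close>

lemma norm_matrix_vector_le_spectral_radius:
  fixes A :: "real^'n^'m"
  shows "(norm (A *v x))\<^sup>2 \<le> spectral_radius (transpose A ** A) * (norm x)\<^sup>2"
proof -
  have "sphere (0 :: real^'n) 1 \<noteq> {}" by simp
  moreover have "continuous_on (sphere 0 1) (\<lambda>v. norm (A *v v))"
    by (intro continuous_intros matrix_vector_mult_linear_continuous_on)
  ultimately obtain v where v: "norm v = 1"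
    and vmax: "\<And>u. norm u = 1 \<Longrightarrow> norm (A *v u) \<le> norm (A *v v)"
    using continuous_attains_sup[OF compact_sphere, of "0 :: real^'n" 1 "\<lambda>v. norm (A *v v)"]
    by auto
  define \<mu> where "\<mu> = (norm (A *v v))\<^sup>2"
  have le: "(norm (A *v u))\<^sup>2 \<le> \<mu> * (norm u)\<^sup>2" for u
  proof (cases "u = 0")
    case False
    have "norm (A *v u) = norm u * norm (A *v (u /\<^sub>R norm u))"
      using False by (simp add: matrix_vector_mult_scaleR)
    also have "\<dots> \<le> norm u * norm (A *v v)"
      using False by (intro mult_left_mono vmax) auto
    finally show ?thesis
      unfolding \<mu>_def by (metis mult.commute norm_ge_zero power_mono power_mult_distrib)
  qed simp
  have grad: "0 \<le> \<mu> * (v \<bullet> y) - (A *v v) \<bullet> (A *v y)" for y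
  proof -
    have "0 \<le> t * (2 * (\<mu> * (v \<bullet> y) - (A *v v) \<bullet> (A *v y)))
        + t\<^sup>2 * (\<mu> * (norm y)\<^sup>2 - (norm (A *v y))\<^sup>2)" for t
      using le[of "v + t *\<^sub>R y"] v
      unfolding matrix_vector_right_distrib matrix_vector_mult_scaleR power2_norm_eq_inner
        norm_eq_1 \<mu>_def
      by (simp add: inner_add inner_commute algebra_simps power2_eq_square)
    from nonneg_if_quadratic_nonneg[OF this] show ?thesis by simp
  qed
  have inner: "(\<mu> *\<^sub>R v - (transpose A ** A) *v v) \<bullet> y = \<mu> * (v \<bullet> y) - (A *v v) \<bullet> (A *v y)" for y
    by (simp add: inner_diff_left dot_lmul_matrix flip: matrix_vector_mul_assoc)
  have "(\<mu> *\<^sub>R v - (transpose A ** A) *v v) \<bullet> y = 0" for y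
    using grad[of y] grad[of "- y"] unfolding inner
    by (simp add: linear_neg[OF matrix_vector_mul_linear])
  then have "(transpose A ** A) *v v = \<mu> *\<^sub>R v"
    by (metis inner_eq_zero_iff right_minus_eq)
  moreover have "v \<noteq> 0" using v by auto
  ultimately have "\<mu> \<le> spectral_radius (transpose A ** A)"
    using real_eigenvalue_le_spectral_radius by (metis abs_le_iff)
  with le[of x] show ?thesis
    by (meson mult_right_mono order_trans zero_le_power2)
qed

section \<open>Descent of the indefinite linearized method\<close>

text \<open>
  The nonnegative orthant is replaced by an arbitrary closed convex set \<open>C\<close> of multipliers, and
  the matrix by a linear map. The predicted primal point is \<open>x (Suc k)\<close> itself; the predicted
  multiplier is \<open>p k\<close>.
\<close>

locale indefinite_linearized_alm =
  fixes \<theta> :: "'a::euclidean_space \<Rightarrow> real"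
    and X :: "'a set"
    and C :: "'b::euclidean_space set"
    and A :: "'a \<Rightarrow> 'b"
    and b :: 'b
    and \<beta> r \<tau> :: real
    and x :: "nat \<Rightarrow> 'a"
    and l p :: "nat \<Rightarrow> 'b"
  assumes convex_\<theta>: "convex_on X \<theta>" and continuous_\<theta>: "continuous_on X \<theta>"
    and closed_X: "closed X" and convex_X: "convex X"
    and closed_C: "closed C" and convex_C: "convex C" and nonempty_C: "C \<noteq> {}"
    and linear_A: "linear A"
    and \<beta>_pos: "0 < \<beta>" and r_pos: "0 < r" and \<tau>_gt: "3 / 4 < \<tau>" and \<tau>_less: "\<tau> < 1"
    and A_bound: "\<And>u. \<beta> * (norm (A u))\<^sup>2 \<le> r * (norm u)\<^sup>2"
    and predict_multiplier: "\<And>k. p k = closest_point C (l k - \<beta> *\<^sub>R (A (x k) - b))"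
    and predict_primal: "\<And>k. is_arg_min
           (\<lambda>y. \<theta> y - p k \<bullet> A y + \<tau> * r / 2 * (norm (y - x k))\<^sup>2) (\<lambda>y. y \<in> X) (x (Suc k))"
    and correct_multiplier: "\<And>k. l (Suc k) = p k + \<beta> *\<^sub>R A (x k - x (Suc k))"
begin

definition lagrangian :: "'a \<Rightarrow> 'b \<Rightarrow> real" where
  "lagrangian y \<mu> = \<theta> y - \<mu> \<bullet> (A y - b)"

definition saddle_point :: "'a \<Rightarrow> 'b \<Rightarrow> bool" where
  "saddle_point xs ls \<longleftrightarrow> xs \<in> X \<and> ls \<in> C \<and>
     (\<forall>y\<in>X. \<forall>\<mu>\<in>C. lagrangian xs \<mu> \<le> lagrangian y ls)"

definition d :: "nat \<Rightarrow> 'a" where "d k = x k - x (Suc k)"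

definition e :: "nat \<Rightarrow> 'b" where "e k = l k - l (Suc k)"

text \<open>
  The terms in \<open>d k\<close> are the part of the second half of the cross term that telescopes. They are
  nonnegative because they equal
  \<open>(\<tau> (r |d\<^sub>k|\<^sup>2 - \<beta> |A d\<^sub>k|\<^sup>2) + (1 - \<tau>) \<beta> |A d\<^sub>k|\<^sup>2) / 2\<close>.
  The index is shifted by one since \<open>x 0\<close> may lie outside \<open>X\<close>.
\<close>

definition potential :: "'a \<Rightarrow> 'b \<Rightarrow> nat \<Rightarrow> real" where
  "potential xs ls k =
     \<tau> * r * (norm (x (Suc k) - xs))\<^sup>2 + (norm (l (Suc k) - ls))\<^sup>2 / \<beta>
     + (\<tau> * r * (norm (d k))\<^sup>2 + (1 - 2 * \<tau>) * \<beta> * (norm (A (d k)))\<^sup>2) / 2"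

lemma x_mem: "x (Suc k) \<in> X"
  using predict_primal[of k] by (simp add: is_arg_min_def)

lemma p_mem: "p k \<in> C"
  unfolding predict_multiplier using closed_C nonempty_C by (rule closest_point_in_set)

lemma p_eq: "p k = l (Suc k) - \<beta> *\<^sub>R A (d k)"
  by (simp add: correct_multiplier d_def)

lemma primal_inequality:
  assumes "y \<in> X"
  shows "\<tau> * r * ((y - x (Suc k)) \<bullet> d k) \<le> \<theta> y - \<theta> (x (Suc k)) - p k \<bullet> A (y - x (Suc k))"
  unfolding d_def
  by (rule proximal_minimiser_variational[OF convex_\<theta> convex_X predict_primal _ assms])
     (auto intro!: linearI simp: linear_add[OF linear_A] linear_scale[OF linear_A] inner_add_right)

lemma multiplier_inequality:
  assumes "\<mu> \<in> C"
  shows "(\<mu> - p k) \<bullet> e k / \<beta> \<le> (\<mu> - p k) \<bullet> (A (x (Suc k)) - b)"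
proof -
  have "(l k - \<beta> *\<^sub>R (A (x k) - b) - p k) \<bullet> (\<mu> - p k) \<le> 0"
    unfolding predict_multiplier using convex_C closed_C assms by (rule closest_point_dot)
  also have "l k - \<beta> *\<^sub>R (A (x k) - b) - p k = e k - \<beta> *\<^sub>R (A (x (Suc k)) - b)"
    by (simp add: e_def correct_multiplier linear_diff[OF linear_A] algebra_simps)
  finally have "(\<mu> - p k) \<bullet> e k \<le> \<beta> * ((\<mu> - p k) \<bullet> (A (x (Suc k)) - b))"
    by (simp only: inner_commute[of _ "\<mu> - p k"] inner_diff_right[of "\<mu> - p k"]
        inner_scaleR_right diff_le_0_iff_le)
  with \<beta>_pos show ?thesis by (simp add: pos_divide_le_eq mult.commute)
qed

text \<open>
  The multiplier test vector enters only through \<open>L (x\<^sub>k\<^sub>+\<^sub>1) \<mu>\<close> and the primal one only through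
  \<open>L y (p\<^sub>k)\<close>, so the sum of the two optimality conditions is a perturbed saddle inequality.
\<close>

lemma predictor_inequality:
  assumes "y \<in> X" "\<mu> \<in> C"
  shows "\<tau> * r * ((y - x (Suc k)) \<bullet> d k) + (\<mu> - p k) \<bullet> e k / \<beta>
      \<le> lagrangian y (p k) - lagrangian (x (Suc k)) \<mu>"
proof -
  have "lagrangian y (p k) - lagrangian (x (Suc k)) \<mu>
      = (\<theta> y - \<theta> (x (Suc k)) - p k \<bullet> A (y - x (Suc k))) + (\<mu> - p k) \<bullet> (A (x (Suc k)) - b)"
    by (simp add: lagrangian_def linear_diff[OF linear_A] inner_diff algebra_simps)
  then show ?thesis
    using primal_inequality[OF assms(1), of k] multiplier_inequality[OF assms(2), of k] by simp
qed

lemma distance_decrease: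
  assumes "saddle_point xs ls"
  shows "\<tau> * r * (norm (x (Suc k) - xs))\<^sup>2 + (norm (l (Suc k) - ls))\<^sup>2 / \<beta>
      \<le> \<tau> * r * (norm (x k - xs))\<^sup>2 + (norm (l k - ls))\<^sup>2 / \<beta>
        - (\<tau> * r * (norm (d k))\<^sup>2 + (norm (e k))\<^sup>2 / \<beta> + 2 * (A (d k) \<bullet> e k))"
proof -
  have mem: "xs \<in> X" "ls \<in> C"
    and "lagrangian xs (p k) \<le> lagrangian (x (Suc k)) ls"
    using assms x_mem p_mem by (auto simp: saddle_point_def)
  with predictor_inequality[OF mem, of k]
  have "\<tau> * r * ((xs - x (Suc k)) \<bullet> d k) + (ls - p k) \<bullet> e k / \<beta> \<le> 0"
    by linarith
  moreover have "(ls - p k) \<bullet> e k / \<beta> = (ls - l (Suc k)) \<bullet> e k / \<beta> + A (d k) \<bullet> e k"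
    using \<beta>_pos by (simp add: p_eq inner_diff inner_add_left field_simps)
  moreover have primal: "(norm (x k - xs))\<^sup>2
      = (norm (x (Suc k) - xs))\<^sup>2 + (norm (d k))\<^sup>2 - 2 * ((xs - x (Suc k)) \<bullet> d k)"
    unfolding power2_norm_eq_inner d_def by (simp add: inner_diff inner_commute)
  moreover have dual: "(norm (l k - ls))\<^sup>2
      = (norm (l (Suc k) - ls))\<^sup>2 + (norm (e k))\<^sup>2 - 2 * ((ls - l (Suc k)) \<bullet> e k)"
    unfolding power2_norm_eq_inner e_def by (simp add: inner_diff inner_commute)
  ultimately show ?thesis
    unfolding primal dual by (simp add: algebra_simps add_divide_distrib diff_divide_distrib)
qed

text \<open>
  Test the minimality of each of two consecutive primal iterates against the other one: the values of \<open>\<theta>\<close>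
  cancel, and the difference of the predicted multipliers is
  \<open>p\<^sub>k - p\<^sub>k\<^sub>+\<^sub>1 = e\<^sub>k\<^sub>+\<^sub>1 + \<beta> A (d\<^sub>k\<^sub>+\<^sub>1 - d\<^sub>k)\<close>.
\<close>

lemma cross_term_bound:
  "\<tau> * r * (d (Suc k) \<bullet> (d (Suc k) - d k)) - \<beta> * (A (d (Suc k)) \<bullet> A (d (Suc k) - d k))
     \<le> A (d (Suc k)) \<bullet> e (Suc k)"
proof -
  have "\<tau> * r * (d (Suc k) \<bullet> d (Suc k))
      \<le> \<theta> (x (Suc k)) - \<theta> (x (Suc (Suc k))) - p (Suc k) \<bullet> A (d (Suc k))"
    using primal_inequality[OF x_mem, of k "Suc k"] by (simp flip: d_def)
  moreover have "- (\<tau> * r * (d (Suc k) \<bullet> d k))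
      \<le> \<theta> (x (Suc (Suc k))) - \<theta> (x (Suc k)) + p k \<bullet> A (d (Suc k))"
  proof -
    have "x (Suc (Suc k)) - x (Suc k) = - d (Suc k)" by (simp add: d_def)
    then show ?thesis
      using primal_inequality[OF x_mem, of "Suc k" k] by (simp add: linear_neg[OF linear_A])
  qed
  moreover have "p k - p (Suc k) = e (Suc k) + \<beta> *\<^sub>R A (d (Suc k) - d k)"
    by (simp add: p_eq e_def linear_diff[OF linear_A] algebra_simps)
  then have "p k \<bullet> A (d (Suc k)) - p (Suc k) \<bullet> A (d (Suc k))
      = A (d (Suc k)) \<bullet> e (Suc k) + \<beta> * (A (d (Suc k)) \<bullet> A (d (Suc k) - d k))"
    by (metis inner_add_right inner_commute inner_diff_right inner_scaleR_right)
  ultimately show ?thesis by (simp add: inner_diff_right algebra_simps)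
qed

lemma potential_decrease:
  assumes "saddle_point xs ls"
  shows "potential xs ls (Suc k) + 3 * (\<tau> - 3 / 4) * r * (norm (d (Suc k)))\<^sup>2
      + (norm (e (Suc k) + (\<beta> / 2) *\<^sub>R A (d (Suc k))))\<^sup>2 / \<beta> \<le> potential xs ls k"
proof -
  define D E u v where "D = d (Suc k)" and "E = d k" and "u = A D" and "v = A E"
  have square: "(norm (e (Suc k) + (\<beta> / 2) *\<^sub>R u))\<^sup>2 / \<beta>
      = (norm (e (Suc k)))\<^sup>2 / \<beta> + u \<bullet> e (Suc k) + \<beta> * (u \<bullet> u) / 4"
    using \<beta>_pos unfolding power2_norm_eq_inner
    by (simp add: inner_add inner_commute field_simps power2_eq_square)
  have cross: "\<tau> * r * (D \<bullet> D - D \<bullet> E) - \<beta> * (u \<bullet> u - u \<bullet> v) \<le> u \<bullet> e (Suc k)"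
    using cross_term_bound[of k]
    by (simp add: D_def E_def u_def v_def linear_diff[OF linear_A] inner_diff_right)
  have "\<tau> * (\<beta> * (norm (A (D - E)))\<^sup>2) \<le> \<tau> * (r * (norm (D - E))\<^sup>2)"
    using A_bound \<tau>_gt by (intro mult_left_mono) auto
  then have n1: "\<tau> * (\<beta> * (u \<bullet> u - 2 * (u \<bullet> v) + v \<bullet> v))
      \<le> \<tau> * (r * (D \<bullet> D - 2 * (D \<bullet> E) + E \<bullet> E))"
    by (simp add: power2_norm_eq_inner linear_diff[OF linear_A] inner_diff inner_commute
        u_def v_def algebra_simps)
  have "0 \<le> (1 - \<tau>) * (\<beta> * (norm (u + v))\<^sup>2)"
    using \<tau>_less \<beta>_pos by simp
  then have n2: "0 \<le> (1 - \<tau>) * (\<beta> * (u \<bullet> u + 2 * (u \<bullet> v) + v \<bullet> v))"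
    by (simp add: power2_norm_eq_inner inner_add inner_commute algebra_simps)
  have "0 \<le> (9 / 4 - 2 * \<tau>) * (r * (norm D)\<^sup>2 - \<beta> * (norm u)\<^sup>2)"
    using A_bound[of D] \<tau>_less by (simp add: u_def)
  then have n3: "0 \<le> (9 / 4 - 2 * \<tau>) * (r * (D \<bullet> D) - \<beta> * (u \<bullet> u))"
    by (simp add: power2_norm_eq_inner)
  \<comment> \<open>The difference of the two sides is half of each of the first two inequalities plus the third.\<close>
  have quadratic: "(\<tau> * r * (D \<bullet> D) + (1 - 2 * \<tau>) * \<beta> * (u \<bullet> u)) / 2 + 3 * (\<tau> - 3 / 4) * r * (D \<bullet> D)
      \<le> \<tau> * r * (D \<bullet> D) + (\<tau> * r * (D \<bullet> D - D \<bullet> E) - \<beta> * (u \<bullet> u - u \<bullet> v)) - \<beta> * (u \<bullet> u) / 4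
        + (\<tau> * r * (E \<bullet> E) + (1 - 2 * \<tau>) * \<beta> * (v \<bullet> v)) / 2"
    using n1 n2 n3 by (simp add: algebra_simps add_divide_distrib diff_divide_distrib)
  define M where "M j = \<tau> * r * (norm (x j - xs))\<^sup>2 + (norm (l j - ls))\<^sup>2 / \<beta>" for j
  have dist: "M (Suc (Suc k)) \<le> M (Suc k)
      - (\<tau> * r * (D \<bullet> D) + (norm (e (Suc k)))\<^sup>2 / \<beta> + 2 * (u \<bullet> e (Suc k)))"
    using distance_decrease[OF assms, of "Suc k"]
    by (simp only: M_def D_def u_def power2_norm_eq_inner)
  have new: "potential xs ls (Suc k)
      = M (Suc (Suc k)) + (\<tau> * r * (D \<bullet> D) + (1 - 2 * \<tau>) * \<beta> * (u \<bullet> u)) / 2"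
    by (simp only: potential_def M_def D_def u_def power2_norm_eq_inner)
  have old: "potential xs ls k
      = M (Suc k) + (\<tau> * r * (E \<bullet> E) + (1 - 2 * \<tau>) * \<beta> * (v \<bullet> v)) / 2"
    by (simp only: potential_def M_def E_def v_def power2_norm_eq_inner)
  have "p1 + q + sq \<le> p0"
    if "m2 \<le> m1 - (a + ee + 2 * ue)" "p1 = m2 + f1" "p0 = m1 + f0"
      "f1 + q \<le> a + g - bu + f0" "g \<le> ue" "sq = ee + ue + bu"
    for p0 p1 q sq m1 m2 a ee ue f0 f1 g bu :: real
    using that by linarith
  from this[OF dist new old quadratic cross square]
  show ?thesis by (simp only: D_def u_def power2_norm_eq_inner)
qed

section \<open>Convergence\<close>

lemma potential_lower_bound:
  "\<tau> * r * (norm (x (Suc k) - xs))\<^sup>2 + (norm (l (Suc k) - ls))\<^sup>2 / \<beta> \<le> potential xs ls k"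
proof -
  have "0 \<le> \<tau> * (r * (norm (d k))\<^sup>2 - \<beta> * (norm (A (d k)))\<^sup>2)
      + (1 - \<tau>) * (\<beta> * (norm (A (d k)))\<^sup>2)"
    using A_bound[of "d k"] \<tau>_gt \<tau>_less \<beta>_pos by simp
  also have "\<dots> = \<tau> * r * (norm (d k))\<^sup>2 + (1 - 2 * \<tau>) * \<beta> * (norm (A (d k)))\<^sup>2"
    by (simp add: algebra_simps)
  finally show ?thesis by (simp add: potential_def)
qed

lemma potential_bounds_primal: "\<tau> * r * (norm (x (Suc k) - xs))\<^sup>2 \<le> potential xs ls k"
proof -
  have "0 \<le> (norm (l (Suc k) - ls))\<^sup>2 / \<beta>" using \<beta>_pos by simp
  with potential_lower_bound[of k xs ls] show ?thesis by linarith
qed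

lemma potential_bounds_multiplier: "(norm (l (Suc k) - ls))\<^sup>2 / \<beta> \<le> potential xs ls k"
proof -
  have "0 \<le> \<tau> * r * (norm (x (Suc k) - xs))\<^sup>2" using \<tau>_gt r_pos by simp
  with potential_lower_bound[of k xs ls] show ?thesis by linarith
qed

lemma potential_nonneg: "0 \<le> potential xs ls k"
proof -
  have "0 \<le> (norm (l (Suc k) - ls))\<^sup>2 / \<beta>" using \<beta>_pos by simp
  also have "\<dots> \<le> potential xs ls k" by (rule potential_bounds_multiplier)
  finally show ?thesis .
qed

lemma potential_decseq:
  assumes "saddle_point xs ls"
  shows "decseq (potential xs ls)"
proof (rule decseq_SucI)
  fix k
  have "0 \<le> 3 * (\<tau> - 3 / 4) * r * (norm (d (Suc k)))\<^sup>2"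
    using \<tau>_gt r_pos by simp
  moreover have "0 \<le> (norm (e (Suc k) + (\<beta> / 2) *\<^sub>R A (d (Suc k))))\<^sup>2 / \<beta>"
    using \<beta>_pos by simp
  ultimately show "potential xs ls (Suc k) \<le> potential xs ls k"
    using potential_decrease[OF assms, of k] by linarith
qed

lemma potential_convergent:
  assumes "saddle_point xs ls"
  obtains V where "potential xs ls \<longlonglongrightarrow> V"
proof -
  have "\<forall>k. 0 \<le> potential xs ls k" using potential_nonneg by blast
  from decseq_convergent[OF potential_decseq[OF assms] this]
  obtain V where "potential xs ls \<longlonglongrightarrow> V" .
  then show ?thesis by (rule that)
qed

lemma tendsto_A:
  assumes "(f \<longlongrightarrow> a) F"
  shows "((\<lambda>k. A (f k)) \<longlongrightarrow> A a) F"
  using linear_A assms by (rule linear_linear[THEN iffD2, THEN bounded_linear.tendsto])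

lemma successive_differences_tendsto_zero:
  assumes "saddle_point xs ls"
  shows "d \<longlonglongrightarrow> 0" "e \<longlonglongrightarrow> 0"
proof -
  obtain V where V: "potential xs ls \<longlonglongrightarrow> V"
    using potential_convergent[OF assms] .
  let ?g = "\<lambda>k. potential xs ls k - potential xs ls (Suc k)"
  have "?g \<longlonglongrightarrow> V - V"
    using V LIMSEQ_Suc[OF V] by (rule tendsto_diff)
  then have g: "?g \<longlonglongrightarrow> 0" by simp
  have parts: "0 \<le> 3 * (\<tau> - 3 / 4) * r * (norm (d (Suc k)))\<^sup>2"
    "0 \<le> (norm (e (Suc k) + (\<beta> / 2) *\<^sub>R A (d (Suc k))))\<^sup>2 / \<beta>" for k
    using \<tau>_gt r_pos \<beta>_pos by simp_all
  have d': "(\<lambda>k. d (Suc k)) \<longlonglongrightarrow> 0"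
  proof (rule tendsto_zero_if_square_le[OF _ _ g])
    show "0 < 3 * (\<tau> - 3 / 4) * r" using \<tau>_gt r_pos by simp
    show "3 * (\<tau> - 3 / 4) * r * (norm (d (Suc k)))\<^sup>2 \<le> ?g k" for k
      using potential_decrease[OF assms, of k] parts(2)[of k] by linarith
  qed
  then show "d \<longlonglongrightarrow> 0" by (rule LIMSEQ_imp_Suc)
  have sq: "(\<lambda>k. e (Suc k) + (\<beta> / 2) *\<^sub>R A (d (Suc k))) \<longlonglongrightarrow> 0"
  proof (rule tendsto_zero_if_square_le[OF _ _ g])
    show "0 < 1 / \<beta>" using \<beta>_pos by simp
    show "1 / \<beta> * (norm (e (Suc k) + (\<beta> / 2) *\<^sub>R A (d (Suc k))))\<^sup>2 \<le> ?g k" for k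
      using potential_decrease[OF assms, of k] parts(1)[of k] by simp
  qed
  have "(\<lambda>k. e (Suc k) + (\<beta> / 2) *\<^sub>R A (d (Suc k)) - (\<beta> / 2) *\<^sub>R A (d (Suc k)))
      \<longlonglongrightarrow> 0 - (\<beta> / 2) *\<^sub>R A 0"
    by (intro tendsto_diff sq tendsto_scaleR tendsto_const tendsto_A d')
  then have "(\<lambda>k. e (Suc k)) \<longlonglongrightarrow> 0"
    by (simp add: linear_0[OF linear_A])
  then show "e \<longlonglongrightarrow> 0" by (rule LIMSEQ_imp_Suc)
qed

lemma iterates_bounded:
  assumes "saddle_point xs ls"
  shows "bounded (range (\<lambda>k. (x (Suc k), l (Suc k))))"
proof -
  let ?V = "potential xs ls"
  have V: "?V k \<le> ?V 0" for k
    using potential_decseq[OF assms] by (simp add: decseq_def)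
  have "x (Suc k) \<in> cball xs (sqrt (?V 0 / (\<tau> * r)))" for k
  proof -
    have "(norm (x (Suc k) - xs))\<^sup>2 \<le> ?V 0 / (\<tau> * r)"
      using order_trans[OF potential_bounds_primal[of k xs ls] V] \<tau>_gt r_pos
      by (simp add: pos_le_divide_eq mult.commute)
    then show ?thesis by (simp add: dist_norm norm_minus_commute real_le_rsqrt)
  qed
  moreover have "l (Suc k) \<in> cball ls (sqrt (?V 0 * \<beta>))" for k
  proof -
    have "(norm (l (Suc k) - ls))\<^sup>2 \<le> ?V 0 * \<beta>"
      using order_trans[OF potential_bounds_multiplier[of k ls xs] V] \<beta>_pos
      by (simp add: pos_divide_le_eq)
    then show ?thesis by (simp add: dist_norm norm_minus_commute real_le_rsqrt)
  qed
  ultimately have "range (\<lambda>k. (x (Suc k), l (Suc k)))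
      \<subseteq> cball xs (sqrt (?V 0 / (\<tau> * r))) \<times> cball ls (sqrt (?V 0 * \<beta>))"
    by auto
  then show ?thesis
    by (rule bounded_subset[rotated]) (intro bounded_Times bounded_cball)
qed

text \<open>
  The error terms of \<open>predictor_inequality\<close> are inner products of convergent sequences with \<open>d\<close> and
  \<open>e\<close>, so they vanish in the limit and leave the saddle inequality. The predictor and the corrected
  multiplier differ by \<open>\<beta> A d\<^sub>k\<close> and have the same limit, which is how the limit inherits membership in \<open>C\<close>.
\<close>

lemma cluster_point_saddle:
  assumes d0: "d \<longlonglongrightarrow> 0" and e0: "e \<longlonglongrightarrow> 0"
    and s: "strict_mono s"
    and xlim: "(\<lambda>j. x (Suc (s j))) \<longlonglongrightarrow> xi" and llim: "(\<lambda>j. l (Suc (s j))) \<longlonglongrightarrow> li"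
  shows "saddle_point xi li"
proof -
  have ds: "(\<lambda>j. d (s j)) \<longlonglongrightarrow> 0" and es: "(\<lambda>j. e (s j)) \<longlonglongrightarrow> 0"
    using LIMSEQ_subseq_LIMSEQ[OF d0 s] LIMSEQ_subseq_LIMSEQ[OF e0 s] by (simp_all add: o_def)
  have "(\<lambda>j. l (Suc (s j)) - \<beta> *\<^sub>R A (d (s j))) \<longlonglongrightarrow> li - \<beta> *\<^sub>R A 0"
    by (intro tendsto_intros llim tendsto_A ds)
  then have plim: "(\<lambda>j. p (s j)) \<longlonglongrightarrow> li"
    by (simp add: p_eq linear_0[OF linear_A])
  have xi: "xi \<in> X" using closed_X x_mem xlim by (rule closed_sequentially)
  have li: "li \<in> C" using closed_C p_mem plim by (rule closed_sequentially)
  have \<theta>lim: "((\<lambda>j. \<theta> (x (Suc (s j)))) \<longlongrightarrow> \<theta> xi) sequentially"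
    by (rule continuous_on_tendsto_compose[OF continuous_\<theta> xlim xi]) (simp add: x_mem)
  have "lagrangian xi \<mu> \<le> lagrangian y li" if "y \<in> X" "\<mu> \<in> C" for y \<mu>
  proof -
    have gap: "(\<lambda>j. lagrangian y (p (s j)) - lagrangian (x (Suc (s j))) \<mu>)
        \<longlonglongrightarrow> lagrangian y li - lagrangian xi \<mu>"
      unfolding lagrangian_def by (intro tendsto_intros plim \<theta>lim tendsto_A xlim)
    have "(\<lambda>j. \<tau> * r * ((y - x (Suc (s j))) \<bullet> d (s j)) + (\<mu> - p (s j)) \<bullet> e (s j) / \<beta>)
        \<longlonglongrightarrow> \<tau> * r * ((y - xi) \<bullet> 0) + (\<mu> - li) \<bullet> 0 / \<beta>"
      using \<beta>_pos by (intro tendsto_intros plim xlim ds es) simp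
    then have "\<tau> * r * ((y - xi) \<bullet> 0) + (\<mu> - li) \<bullet> 0 / \<beta>
        \<le> lagrangian y li - lagrangian xi \<mu>"
      by (rule LIMSEQ_le[OF _ gap]) (intro exI allI impI predictor_inequality[OF that])
    then show ?thesis by simp
  qed
  with xi li show ?thesis by (auto simp: saddle_point_def)
qed

theorem iterates_converge_to_saddle_point:
  assumes "saddle_point xs ls"
  obtains xi li where "saddle_point xi li" "x \<longlonglongrightarrow> xi" "l \<longlonglongrightarrow> li"
proof -
  note d0 = successive_differences_tendsto_zero(1)[OF assms]
  note e0 = successive_differences_tendsto_zero(2)[OF assms]
  from bounded_imp_convergent_subsequence[OF iterates_bounded[OF assms]]
  obtain wi s where s: "strict_mono s"
    and wlim: "((\<lambda>k. (x (Suc k), l (Suc k))) \<circ> s) \<longlonglongrightarrow> wi" by blast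
  define xi li where "xi = fst wi" and "li = snd wi"
  have xlim: "(\<lambda>j. x (Suc (s j))) \<longlonglongrightarrow> xi" and llim: "(\<lambda>j. l (Suc (s j))) \<longlonglongrightarrow> li"
    using tendsto_fst[OF wlim] tendsto_snd[OF wlim] by (simp_all add: o_def xi_def li_def)
  have saddle: "saddle_point xi li"
    using d0 e0 s xlim llim by (rule cluster_point_saddle)
  obtain V where V: "potential xi li \<longlonglongrightarrow> V"
    using potential_convergent[OF saddle] .
  have ds: "(\<lambda>j. d (s j)) \<longlonglongrightarrow> 0"
    using LIMSEQ_subseq_LIMSEQ[OF d0 s] by (simp add: o_def)
  have "(\<lambda>j. potential xi li (s j)) \<longlonglongrightarrow>
      \<tau> * r * (norm (xi - xi))\<^sup>2 + (norm (li - li))\<^sup>2 / \<beta>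
      + (\<tau> * r * (norm (0::'a))\<^sup>2 + (1 - 2 * \<tau>) * \<beta> * (norm (A 0))\<^sup>2) / 2"
    unfolding potential_def using \<beta>_pos by (intro tendsto_intros xlim llim ds tendsto_A) simp_all
  then have "(\<lambda>j. potential xi li (s j)) \<longlonglongrightarrow> 0"
    by (simp add: linear_0[OF linear_A])
  moreover have "(\<lambda>j. potential xi li (s j)) \<longlonglongrightarrow> V"
    using LIMSEQ_subseq_LIMSEQ[OF V s] by (simp add: o_def)
  ultimately have "V = 0" using LIMSEQ_unique by blast
  with V have V0: "potential xi li \<longlonglongrightarrow> 0" by simp
  have "(\<lambda>k. x (Suc k) - xi) \<longlonglongrightarrow> 0"
    using \<tau>_gt r_pos by (intro tendsto_zero_if_square_le[OF _ potential_bounds_primal V0]) simp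
  then have "x \<longlonglongrightarrow> xi"
    by (rule LIMSEQ_imp_Suc[OF Lim_null[THEN iffD2]])
  moreover have "(\<lambda>k. l (Suc k) - li) \<longlonglongrightarrow> 0"
    using \<beta>_pos potential_bounds_multiplier[of _ li xi]
    by (intro tendsto_zero_if_square_le[of "1 / \<beta>", OF _ _ V0]) simp_all
  then have "l \<longlonglongrightarrow> li"
    by (rule LIMSEQ_imp_Suc[OF Lim_null[THEN iffD2]])
  ultimately show ?thesis using that saddle by blast
qed

end

section \<open>The inequality-constrained problem\<close>

lemma closed_nonneg_orthant: "closed (nonneg_orthant :: (real^'m) set)"
  using closed_eucl_atLeast[of "0 :: real^'m"] by (simp add: nonneg_orthant_def atLeast_def)

lemma convex_nonneg_orthant: "convex (nonneg_orthant :: (real^'m) set)"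
  by (auto simp: nonneg_orthant_def convex_def less_eq_vec_def)

text \<open>
  The linear part of the variational inequality map is skew, so the terms \<open>\<lambda> \<bullet> A x\<close> taken at \<open>w\<close> cancel, and the gap
  splits into one Lagrangian value with the multiplier of \<open>w\<close> and one with its primal point.
\<close>

lemma VI_gap_eq_lagrangian_difference:
  "\<theta> (fst v) - \<theta> (fst w) + (v - w) \<bullet> VI_map A b w
     = (\<theta> (fst v) - snd w \<bullet> (A *v fst v - b)) - (\<theta> (fst w) - snd v \<bullet> (A *v fst w - b))"
proof -
  have "(fst v - fst w) \<bullet> (transpose A *v snd w) = snd w \<bullet> (A *v fst v - A *v fst w)"
    by (simp only: transpose_matrix_vector inner_commute[of "fst v - fst w"] dot_lmul_matrix
        matrix_vector_mult_diff_distrib)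
  then have "(v - w) \<bullet> VI_map A b w
      = (snd v - snd w) \<bullet> (A *v fst w - b) - snd w \<bullet> (A *v fst v - A *v fst w)"
    by (simp add: VI_map_def inner_prod_def)
  then show ?thesis
    by (simp add: inner_diff_left inner_diff_right)
qed

theorem theorem4p2:
  fixes \<theta> :: "real^'n \<Rightarrow> real"
    and X :: "(real^'n) set"
    and A :: "real^'n^'m"
    and b :: "real^'m"
    and \<beta> r \<tau> :: real
    and w wt :: "nat \<Rightarrow> (real^'n) \<times> (real^'m)"
  assumes "closed_proper_convex \<theta>"
    and "X \<noteq> {}" "closed X" "convex X"
    and "solution_set \<theta> X A b \<noteq> {}"
    and "Omega_star \<theta> X A b \<noteq> {}"
    and "\<beta> > 0"
    and "r > \<beta> * spectral_radius (transpose A ** A)"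
    and "\<tau> \<in> {0.75<..<1}"
    and "I_IDL_ALM \<theta> X A b \<beta> r \<tau> w wt"
  shows "\<exists>w_inf \<in> Omega_star \<theta> X A b. w \<longlonglongrightarrow> w_inf"
proof -
  let ?\<rho> = "spectral_radius (transpose A ** A)"
  have conv: "convex_on UNIV \<theta>"
    using assms(1) by (simp add: closed_proper_convex_def)
  have bound: "\<beta> * (norm (A *v u))\<^sup>2 \<le> r * (norm u)\<^sup>2" for u
  proof -
    have "\<beta> * (norm (A *v u))\<^sup>2 \<le> \<beta> * (?\<rho> * (norm u)\<^sup>2)"
      using assms(7) norm_matrix_vector_le_spectral_radius by (intro mult_left_mono) auto
    also have "\<dots> = (\<beta> * ?\<rho>) * (norm u)\<^sup>2" by simp
    also have "\<dots> \<le> r * (norm u)\<^sup>2" using assms(8) by (intro mult_right_mono) auto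
    finally show ?thesis .
  qed
  have "0 \<le> ?\<rho>"
  proof -
    obtain u :: "real^'n" where "norm u = 1" using vector_choose_size[of 1] by auto
    then have "(norm (A *v u))\<^sup>2 \<le> ?\<rho>"
      using norm_matrix_vector_le_spectral_radius[of A u] by simp
    then show ?thesis by (rule order_trans[OF zero_le_power2])
  qed
  then have "0 \<le> \<beta> * ?\<rho>" using assms(7) by simp
  with assms(8) have r: "0 < r" by linarith
  note step = assms(10)[unfolded I_IDL_ALM_def proj_nonneg_def, rule_format]
  interpret indefinite_linearized_alm \<theta> X nonneg_orthant "\<lambda>u. A *v u" b \<beta> r \<tau>
    "\<lambda>k. fst (w k)" "\<lambda>k. snd (w k)" "\<lambda>k. snd (wt k)"
  proof
    show "convex_on X \<theta>" using conv by (rule convex_on_subset) (use assms(4) in auto)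
    show "continuous_on X \<theta>"
      using convex_on_continuous[OF open_UNIV conv] by (rule continuous_on_subset) simp
    show "(nonneg_orthant :: (real^'m) set) \<noteq> {}" by (auto simp: nonneg_orthant_def)
    show "3 / 4 < \<tau>" "\<tau> < 1" using assms(9) by auto
    fix k
    show "snd (wt k) = closest_point nonneg_orthant (snd (w k) - \<beta> *\<^sub>R (A *v fst (w k) - b))"
      and "snd (w (Suc k)) = snd (wt k) + \<beta> *\<^sub>R (A *v (fst (w k) - fst (w (Suc k))))"
      using step[of k] by blast+
    have "fst (w (Suc k)) = fst (wt k)" using step[of k] by blast
    then show "is_arg_min
        (\<lambda>y. \<theta> y - snd (wt k) \<bullet> (A *v y) + \<tau> * r / 2 * (norm (y - fst (w k)))\<^sup>2)
        (\<lambda>y. y \<in> X) (fst (w (Suc k)))"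
      using step[of k] by argo
  qed (fact assms(3,4,7) closed_nonneg_orthant convex_nonneg_orthant r bound
      matrix_vector_right_distrib matrix_vector_mult_scaleR)+
  have saddle_iff: "saddle_point (fst v) (snd v) \<longleftrightarrow> v \<in> Omega_star \<theta> X A b" for v
    unfolding saddle_point_def Omega_star_def Omega_def lagrangian_def
      VI_gap_eq_lagrangian_difference by (auto simp: mem_Times_iff)
  obtain ws where "ws \<in> Omega_star \<theta> X A b" using assms(6) by blast
  then obtain xi li where xl: "saddle_point xi li"
    "(\<lambda>k. fst (w k)) \<longlonglongrightarrow> xi" "(\<lambda>k. snd (w k)) \<longlonglongrightarrow> li"
    using iterates_converge_to_saddle_point saddle_iff by metis
  have "w \<longlonglongrightarrow> (xi, li)"
    using tendsto_Pair[OF xl(2,3)] by simp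
  with xl(1) saddle_iff[of "(xi, li)"] show ?thesis by auto
qed

end
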